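(* The mixing time $t_{mix}(\varepsilon)$ for the quantum walk on the complete graph with $n$ vertices, with walk operator $U$ defined by $$U(ws',vs)=\delta_{ws}\left\{\left(1-\frac2n\right)\delta_{vs'}+\left(-\frac2n\right)(1-\delta_{vs'})\right\},\qquad v,w,s,s'\in\{1,\dots,n\},$$ satisfies the inequalities $$\frac{c_1}{\varepsilon}\le t_{mix}(\varepsilon)\le\frac{c_2}{\varepsilon},$$ where $c_1$ and $c_2$ are positive constants.
   Context: Here the vertex set is $V=\{1,\dots,n\}$ and the set of states is $S=\{1,\dots,n\}$, identified with $V$. $U(ws',vs)=\langle\delta_{(w,s')},U\delta_{(v,s)}\rangle$ are the matrix entries of the unitary operator $U$ on $L^2_{\mathbb{C}}(V\times S)$, where $\delta_{(v,s)}$ are the standard basis vectors and $\delta_{ws}$, $\delta_{vs'}$ are Kronecker symbols: a particle at vertex $v$ in state $s$ moves to vertex $w=s$, and to state $s'$ with amplitude $1-2/n$ if $s'=v$ and $-2/n$ if $s'\ne v$. Mixing time: for $\psi\in L^2_{\mathbb{C}}(V\times S)$ with $\|\psi\|=1$ let $\psi_t=U^t\psi$, let $$p(x)=\lim_{T\to\infty}\frac1T\sum_{t=0}^{T-1}|\psi_t(x)|^2$$ (the limit exists and may depend on $\psi$), and for $T=1,2,\dots$ let $$d(T,\psi)=\sum_{x\in V\times S}\left|\frac1T\sum_{t=0}^{T-1}|\psi_t(x)|^2-p(x)\right|.$$ Then $$t_{mix}(\varepsilon)=\sup_{\psi}\ \inf\{T: d(T',\psi)\le\varepsilon \text{ for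 all } T'\ge T\},$$ the supremum being over all $\psi$ with $\|\psi\|=1$.
   Formalization: Stated for n ≥ 2 (for n = 1 the mixing time is always 1, so the lower bound fails for small ε), and the upper bound is for 0 < ε ≤ 2 (for ε ≥ 2 the mixing time is 1, so it fails for ε > c_2); the constants do not depend on n or ε. *)

theory Defs
  imports "HOL-Analysis.L2_Norm" "HOL-Library.Extended_Real"
begin

text \<open>
  A walk on a finite configuration set \<open>X\<close> (below \<open>X = V \<times> S\<close>) is given by its matrix
  \<open>U x y\<close> = amplitude of the transition from \<open>y\<close> to \<open>x\<close>. The size of \<open>X\<close> has to vary inside the
  theorem, so vectors of $L^2_{\mathbb C}(X)$ are functions that vanish outside the carrier set \<open>X\<close>.
\<close>

definition unit_vectors :: "'x set \<Rightarrow> ('x \<Rightarrow> complex) set" where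
  "unit_vectors X = {\<psi>. (\<forall>x. x \<notin> X \<longrightarrow> \<psi> x = 0) \<and> L2_set (\<lambda>x. cmod (\<psi> x)) X = 1}"

definition apply_operator ::
    "'x set \<Rightarrow> ('x \<Rightarrow> 'x \<Rightarrow> complex) \<Rightarrow> ('x \<Rightarrow> complex) \<Rightarrow> 'x \<Rightarrow> complex" where
  "apply_operator X U \<psi> = (\<lambda>x. if x \<in> X then \<Sum>y\<in>X. U x y * \<psi> y else 0)"

definition walk_state ::
    "'x set \<Rightarrow> ('x \<Rightarrow> 'x \<Rightarrow> complex) \<Rightarrow> ('x \<Rightarrow> complex) \<Rightarrow> nat \<Rightarrow> 'x \<Rightarrow> complex" where
  "walk_state X U \<psi> t = (apply_operator X U ^^ t) \<psi>"

definition time_average ::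
    "'x set \<Rightarrow> ('x \<Rightarrow> 'x \<Rightarrow> complex) \<Rightarrow> ('x \<Rightarrow> complex) \<Rightarrow> nat \<Rightarrow> 'x \<Rightarrow> real" where
  "time_average X U \<psi> T x = 1 / real T * (\<Sum>t<T. (cmod (walk_state X U \<psi> t x))\<^sup>2)"

definition limit_distribution ::
    "'x set \<Rightarrow> ('x \<Rightarrow> 'x \<Rightarrow> complex) \<Rightarrow> ('x \<Rightarrow> complex) \<Rightarrow> 'x \<Rightarrow> real" where
  "limit_distribution X U \<psi> x = lim (\<lambda>T. time_average X U \<psi> T x)"

definition mixing_distance ::
    "'x set \<Rightarrow> ('x \<Rightarrow> 'x \<Rightarrow> complex) \<Rightarrow> nat \<Rightarrow> ('x \<Rightarrow> complex) \<Rightarrow> real" where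
  "mixing_distance X U T \<psi> =
     (\<Sum>x\<in>X. \<bar>time_average X U \<psi> T x - limit_distribution X U \<psi> x\<bar>)"

text \<open>
  The value is extended real, so that neither an infimum over the empty set nor an unbounded
  supremum yields a meaningless number: both give \<open>\<infinity>\<close>.
\<close>

definition mixing_time :: "'x set \<Rightarrow> ('x \<Rightarrow> 'x \<Rightarrow> complex) \<Rightarrow> real \<Rightarrow> ereal" where
  "mixing_time X U \<epsilon> =
     (SUP \<psi>\<in>unit_vectors X.
        INF T\<in>{T. T \<ge> 1 \<and> (\<forall>T'\<ge>T. mixing_distance X U T' \<psi> \<le> \<epsilon>)}. ereal (real T))"

definition complete_configs :: "nat \<Rightarrow> (nat \<times> nat) set" where
  "complete_configs n = {1..n} \<times> {1..n}"

definition complete_walk :: "nat \<Rightarrow> nat \<times> nat \<Rightarrow> nat \<times> nat \<Rightarrow> complex" where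
  "complete_walk n = (\<lambda>(w, s') (v, s).
     of_bool (w = s) *
       ((1 - 2 / of_nat n) * of_bool (v = s') + (- 2 / of_nat n) * (1 - of_bool (v = s'))))"

end

theory Submission
  imports Defs
begin

text \<open>
  Regard a state as an $n \times n$ matrix $\psi$, and let $R = I - \frac2n J$ be the reflection in
  the hyperplane orthogonal to $(1,\dots,1)$, where $J$ is the all-ones matrix. Then
  $U\psi = (R\psi)^T = \psi^T R$, hence $U^2\psi = R \psi R$ and $U^4 = I$. So the position
  probabilities have period 4, the limit distribution is the average over one period, and $T$ times
  the mixing distance depends only on $T$ mod 4 and is bounded. It stays away from 0 for $T = 4k+1$
  and $\psi = \delta_{(1,2)}$, since $U\psi$ vanishes at $(1,2)$.
\<close>

section \<open>Averages of periodic sequences\<close>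

text \<open>One full period contributes exactly \<open>p * A\<close> to the sum, so removing it
  leaves the deviation from the mean unchanged; strong induction on \<open>T\<close> removes all
  full periods.\<close>

lemma sum_periodic_deviation:
  fixes f :: "nat \<Rightarrow> real"
  assumes "p > 0" and periodic: "\<And>t. f (t + p) = f t"
  defines "A \<equiv> (\<Sum>t<p. f t) / real p"
  shows "(\<Sum>t<T. f t) - real T * A = (\<Sum>t<T mod p. f t) - real (T mod p) * A"
proof (induction T rule: less_induct)
  case (less T)
  show ?case
  proof (cases "T < p")
    case True
    then show ?thesis by simp
  next
    case False
    define m where "m = T - p"
    with False \<open>p > 0\<close> have T: "T = p + m" and "m < T" by auto
    have "(\<Sum>t<T. f t) = (\<Sum>t<p. f t) + (\<Sum>t<m. f (t + p))"
      unfolding T by (induction m) (simp_all add: add.commute)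
    also have "\<dots> = real p * A + (\<Sum>t<m. f t)"
      using \<open>p > 0\<close> by (simp add: periodic A_def)
    finally show ?thesis
      using less.IH[OF \<open>m < T\<close>] by (simp add: T algebra_simps)
  qed
qed

text \<open>The average differs from the mean over one period by \<open>D (T mod p) / T\<close>, and
  \<open>D (T mod p)\<close> takes only finitely many values, so the error is O(1/T).\<close>

lemma periodic_average_tendsto:
  fixes f :: "nat \<Rightarrow> real"
  assumes "p > 0" and periodic: "\<And>t. f (t + p) = f t"
  shows "(\<lambda>T. 1 / real T * (\<Sum>t<T. f t)) \<longlonglongrightarrow> (\<Sum>t<p. f t) / real p"
proof -
  define A where "A = (\<Sum>t<p. f t) / real p"
  define D where "D r = (\<Sum>t<r. f t) - real r * A" for r
  have "(\<lambda>T. D (T mod p) * (1 / real T)) \<longlonglongrightarrow> 0"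
  proof (rule tendsto_0_le[OF lim_1_over_n])
    have "\<bar>D (T mod p)\<bar> \<le> (\<Sum>r<p. \<bar>D r\<bar>)" for T
      using \<open>p > 0\<close> by (intro member_le_sum[where f = "\<lambda>r. \<bar>D r\<bar>"]) auto
    then show "\<forall>\<^sub>F T in sequentially.
        norm (D (T mod p) * (1 / real T)) \<le> norm (1 / real T) * (\<Sum>r<p. \<bar>D r\<bar>)"
      by (simp add: divide_right_mono)
  qed
  from tendsto_add[OF tendsto_const[of A] this]
  have "(\<lambda>T. A + D (T mod p) * (1 / real T)) \<longlonglongrightarrow> A"
    by simp
  \<comment> \<open>Only eventual equality is available: at \<open>T = 0\<close> division by zero
    makes the right side 0, whereas the left side is \<open>A\<close>.\<close>
  moreover have "\<forall>\<^sub>F T in sequentially. A + D (T mod p) * (1 / real T) = 1 / real T * (\<Sum>t<T. f t)"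
    using eventually_gt_at_top[of 0]
  proof eventually_elim
    case (elim T)
    have "D (T mod p) = (\<Sum>t<T. f t) - real T * A"
      using sum_periodic_deviation[where f = f and p = p and T = T, OF assms] by (simp add: D_def A_def)
    with elim show ?case by (simp add: field_simps)
  qed
  ultimately show ?thesis
    unfolding A_def[symmetric] by (rule Lim_transform_eventually)
qed

section \<open>Walks with a periodic orbit\<close>

lemma walk_state_0 [simp]: "walk_state X U \<psi> 0 = \<psi>"
  by (simp add: walk_state_def)

lemma walk_state_Suc [simp]: "walk_state X U \<psi> (Suc t) = apply_operator X U (walk_state X U \<psi> t)"
  by (simp add: walk_state_def)

lemma walk_state_add: "walk_state X U \<psi> (s + t) = walk_state X U (walk_state X U \<psi> t) s"
  by (simp add: walk_state_def funpow_add)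

text \<open>Only the one orbit starting at \<open>\<psi>\<close> is required to close up after
  \<open>p\<close> steps, and \<open>p\<close> may be any period, not necessarily the least
  one.\<close>

context
  fixes X :: "'x set" and U :: "'x \<Rightarrow> 'x \<Rightarrow> complex" and \<psi> :: "'x \<Rightarrow> complex" and p :: nat
  assumes period_pos: "p > 0" and state_period: "walk_state X U \<psi> p = \<psi>"
begin

lemma walk_state_periodic: "walk_state X U \<psi> (t + p) = walk_state X U \<psi> t"
  by (simp add: walk_state_add state_period)

lemma limit_distribution_periodic:
  "limit_distribution X U \<psi> x = (\<Sum>t<p. (cmod (walk_state X U \<psi> t x))\<^sup>2) / real p"
proof -
  have "(\<lambda>T. time_average X U \<psi> T x) \<longlonglongrightarrow> (\<Sum>t<p. (cmod (walk_state X U \<psi> t x))\<^sup>2) / real p"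
    unfolding time_average_def
    by (rule periodic_average_tendsto[OF period_pos]) (simp add: walk_state_periodic)
  then show ?thesis
    unfolding limit_distribution_def by (rule limI)
qed

text \<open>The limit is the mean over one period, so \<open>sum_periodic_deviation\<close> applies
  at each \<open>x\<close>. Being an exact formula, it serves both the upper and the lower
  bound.\<close>

lemma mixing_distance_periodic:
  assumes "T > 0"
  shows "mixing_distance X U T \<psi> =
    (\<Sum>x\<in>X. \<bar>(\<Sum>t<T mod p. (cmod (walk_state X U \<psi> t x))\<^sup>2)
              - real (T mod p) * limit_distribution X U \<psi> x\<bar>) / real T"
proof -
  have "\<bar>time_average X U \<psi> T x - limit_distribution X U \<psi> x\<bar> =
      \<bar>(\<Sum>t<T mod p. (cmod (walk_state X U \<psi> t x))\<^sup>2)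
        - real (T mod p) * limit_distribution X U \<psi> x\<bar> / real T" for x
  proof -
    have "time_average X U \<psi> T x - limit_distribution X U \<psi> x =
        ((\<Sum>t<T. (cmod (walk_state X U \<psi> t x))\<^sup>2) - real T * limit_distribution X U \<psi> x) / real T"
      using assms by (simp add: time_average_def field_simps)
    also have "(\<Sum>t<T. (cmod (walk_state X U \<psi> t x))\<^sup>2) - real T * limit_distribution X U \<psi> x =
        (\<Sum>t<T mod p. (cmod (walk_state X U \<psi> t x))\<^sup>2)
          - real (T mod p) * limit_distribution X U \<psi> x"
      unfolding limit_distribution_periodic
      by (rule sum_periodic_deviation[OF period_pos]) (simp add: walk_state_periodic)
    finally show ?thesis by simp
  qed
  then show ?thesis
    by (simp add: mixing_distance_def sum_divide_distrib)
qed

text \<open>With \<open>r = T mod p\<close>, the first \<open>r\<close> position distributions and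
  \<open>r\<close> copies of the limit distribution each have total mass \<open>r\<close>, so the
  triangle inequality bounds the numerator by \<open>2 * r\<close>.\<close>

lemma mixing_distance_periodic_le:
  assumes "T > 0" and norm: "\<And>t. (\<Sum>x\<in>X. (cmod (walk_state X U \<psi> t x))\<^sup>2) = 1"
  shows "mixing_distance X U T \<psi> \<le> 2 * real p / real T"
proof -
  define r where "r = T mod p"
  have [simp]: "limit_distribution X U \<psi> x \<ge> 0" for x
    by (simp add: limit_distribution_periodic sum_nonneg)
  have total: "(\<Sum>x\<in>X. \<Sum>t<m. (cmod (walk_state X U \<psi> t x))\<^sup>2) = real m" for m
    by (subst sum.swap) (simp add: norm)
  then have limit_total: "(\<Sum>x\<in>X. limit_distribution X U \<psi> x) = 1"
    using period_pos by (simp add: limit_distribution_periodic flip: sum_divide_distrib)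
  have "(\<Sum>x\<in>X. \<bar>(\<Sum>t<r. (cmod (walk_state X U \<psi> t x))\<^sup>2) - real r * limit_distribution X U \<psi> x\<bar>)
      \<le> (\<Sum>x\<in>X. (\<Sum>t<r. (cmod (walk_state X U \<psi> t x))\<^sup>2) + real r * limit_distribution X U \<psi> x)"
    by (intro sum_mono order.trans[OF abs_triangle_ineq4]) (simp add: sum_nonneg)
  also have "\<dots> = 2 * real r"
    by (simp add: sum.distrib total limit_total flip: sum_distrib_left)
  also have "\<dots> \<le> 2 * real p"
    using period_pos by (simp add: r_def less_imp_le)
  finally show ?thesis
    using \<open>T > 0\<close> by (simp add: mixing_distance_periodic r_def divide_right_mono)
qed

end

section \<open>Unitarity and period of the walk on the complete graph\<close>

text \<open>The map is the reflection R in the hyperplane orthogonal to the all-ones vector, hence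
  an isometry. After expanding the squares, the two cross terms cancel the quadratic term, each pair
  being worth 4/n times \<open>C * cnj C\<close>.\<close>

lemma complex_reflection_norm:
  fixes a :: "'a \<Rightarrow> complex"
  assumes "finite S" "S \<noteq> {}"
  shows "(\<Sum>s\<in>S. (cmod (a s - 2 / of_nat (card S) * (\<Sum>v\<in>S. a v)))\<^sup>2) = (\<Sum>s\<in>S. (cmod (a s))\<^sup>2)"
proof -
  define n where "n = (of_nat (card S) :: complex)"
  define C where "C = (\<Sum>v\<in>S. a v)"
  have "n \<noteq> 0" and cnj_n [simp]: "cnj n = n"
    using assms by (auto simp: n_def)
  have "complex_of_real (\<Sum>s\<in>S. (cmod (a s - 2 / n * C))\<^sup>2) =
      (\<Sum>s\<in>S. a s * cnj (a s) - 2 / n * cnj C * a s - 2 / n * C * cnj (a s) + 4 / n\<^sup>2 * C * cnj C)"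
    unfolding of_real_sum complex_norm_square
    by (intro sum.cong refl) (simp add: algebra_simps power2_eq_square)
  also have "\<dots> = (\<Sum>s\<in>S. a s * cnj (a s)) - 2 / n * cnj C * C - 2 / n * C * cnj C
      + n * (4 / n\<^sup>2 * C * cnj C)"
    by (simp add: sum.distrib sum_subtractf C_def n_def
        flip: sum_distrib_left sum_divide_distrib)
  also have "\<dots> = (\<Sum>s\<in>S. a s * cnj (a s))"
    using \<open>n \<noteq> 0\<close> by (simp add: field_simps power2_eq_square)
  also have "\<dots> = complex_of_real (\<Sum>s\<in>S. (cmod (a s))\<^sup>2)"
    unfolding of_real_sum complex_norm_square ..
  finally show ?thesis
    unfolding n_def C_def of_real_eq_iff .
qed

text \<open>The factor \<open>of_bool (w = u)\<close> selects column \<open>w\<close>, and the coin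
  amplitude simplifies to \<open>of_bool (v = s) - 2 / of_nat n\<close>: column \<open>w\<close> is
  reflected and becomes row \<open>w\<close>.\<close>

lemma apply_complete_walk:
  assumes "w \<in> {1..n}" "s \<in> {1..n}"
  shows "apply_operator (complete_configs n) (complete_walk n) \<psi> (w, s) =
    \<psi> (s, w) - 2 / of_nat n * (\<Sum>v=1..n. \<psi> (v, w))"
proof -
  have "apply_operator (complete_configs n) (complete_walk n) \<psi> (w, s) =
      (\<Sum>v=1..n. \<Sum>u=1..n. complete_walk n (w, s) (v, u) * \<psi> (v, u))"
    using assms by (simp add: apply_operator_def complete_configs_def sum.cartesian_product)
  also have "\<dots> = (\<Sum>v=1..n. \<Sum>u=1..n.
      if u = w then (of_bool (v = s) - 2 / of_nat n) * \<psi> (v, w) else 0)"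
    by (intro sum.cong) (auto simp: complete_walk_def)
  also have "\<dots> = (\<Sum>v=1..n. (of_bool (v = s) - 2 / of_nat n) * \<psi> (v, w))"
    using assms by (simp add: sum.delta)
  also have "\<dots> = (\<Sum>v=1..n. if v = s then \<psi> (v, w) else 0) - 2 / of_nat n * (\<Sum>v=1..n. \<psi> (v, w))"
    unfolding sum_distrib_left sum_subtractf[symmetric]
    by (intro sum.cong) (auto simp: algebra_simps)
  finally show ?thesis
    using assms by (simp add: sum.delta)
qed

text \<open>Each column keeps its norm under the reflection, and the transposition only permutes the
  entries.\<close>

lemma complete_walk_norm:
  assumes "n > 0"
  shows "(\<Sum>x\<in>complete_configs n. (cmod (apply_operator (complete_configs n) (complete_walk n) \<psi> x))\<^sup>2)
    = (\<Sum>x\<in>complete_configs n. (cmod (\<psi> x))\<^sup>2)"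
proof -
  have "(\<Sum>x\<in>complete_configs n. (cmod (apply_operator (complete_configs n) (complete_walk n) \<psi> x))\<^sup>2)
      = (\<Sum>w=1..n. \<Sum>s=1..n.
          (cmod (apply_operator (complete_configs n) (complete_walk n) \<psi> (w, s)))\<^sup>2)"
    by (simp add: complete_configs_def sum.cartesian_product)
  also have "\<dots> = (\<Sum>w=1..n. \<Sum>s=1..n.
      (cmod (\<psi> (s, w) - 2 / of_nat (card {1..n}) * (\<Sum>v=1..n. \<psi> (v, w))))\<^sup>2)"
    by (intro sum.cong refl) (simp add: apply_complete_walk)
  also have "\<dots> = (\<Sum>w=1..n. \<Sum>s=1..n. (cmod (\<psi> (s, w)))\<^sup>2)"
    using assms by (intro sum.cong refl complex_reflection_norm) auto
  also have "\<dots> = (\<Sum>x\<in>complete_configs n. (cmod (\<psi> x))\<^sup>2)"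
    by (subst sum.swap) (simp add: complete_configs_def sum.cartesian_product)
  finally show ?thesis .
qed

text \<open>This is the entry of R\<psi>R written out: the sums are a column sum, a row sum and the
  sum of all entries.\<close>

lemma complete_walk_state_2:
  assumes "w \<in> {1..n}" "s \<in> {1..n}"
  shows "walk_state (complete_configs n) (complete_walk n) \<psi> 2 (w, s) =
    \<psi> (w, s) - 2 / of_nat n * (\<Sum>v=1..n. \<psi> (v, s)) - 2 / of_nat n * (\<Sum>v=1..n. \<psi> (w, v))
      + 4 / (of_nat n)\<^sup>2 * (\<Sum>u=1..n. \<Sum>v=1..n. \<psi> (v, u))"
proof -
  let ?U = "apply_operator (complete_configs n) (complete_walk n)"
  have "(\<Sum>v=1..n. ?U \<psi> (v, w)) = (\<Sum>v=1..n. \<psi> (w, v) - 2 / of_nat n * (\<Sum>u=1..n. \<psi> (u, v)))"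
    using assms by (intro sum.cong) (simp_all add: apply_complete_walk)
  also have "\<dots> = (\<Sum>v=1..n. \<psi> (w, v)) - 2 / of_nat n * (\<Sum>v=1..n. \<Sum>u=1..n. \<psi> (u, v))"
    by (simp add: sum_subtractf sum_distrib_left)
  finally have "?U (?U \<psi>) (w, s) = \<psi> (w, s) - 2 / of_nat n * (\<Sum>v=1..n. \<psi> (v, s))
      - 2 / of_nat n * ((\<Sum>v=1..n. \<psi> (w, v)) - 2 / of_nat n * (\<Sum>v=1..n. \<Sum>u=1..n. \<psi> (u, v)))"
    using assms by (simp add: apply_complete_walk)
  moreover have "walk_state (complete_configs n) (complete_walk n) \<psi> 2 = ?U (?U \<psi>)"
    by (simp add: numeral_2_eq_2)
  ultimately show ?thesis
    by (simp add: algebra_simps power2_eq_square)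
qed

lemma complete_walk_state_4:
  assumes "n > 0" and supp: "\<And>x. x \<notin> complete_configs n \<Longrightarrow> \<psi> x = 0"
  shows "walk_state (complete_configs n) (complete_walk n) \<psi> 4 = \<psi>"
proof
  fix x :: "nat \<times> nat"
  let ?S = "walk_state (complete_configs n) (complete_walk n)"
  define N where "N = (of_nat n :: complex)"
  have "N \<noteq> 0" using assms by (simp add: N_def)
  define \<phi> where "\<phi> = ?S \<psi> 2"
  define col where "col s = (\<Sum>v=1..n. \<psi> (v, s))" for s
  define row where "row w = (\<Sum>v=1..n. \<psi> (w, v))" for w
  define tot where "tot = (\<Sum>u=1..n. col u)"
  have row_tot: "(\<Sum>w=1..n. row w) = tot"
    unfolding row_def tot_def col_def by (rule sum.swap)
  have \<phi>: "\<phi> (w, s) = \<psi> (w, s) - 2 / N * col s - 2 / N * row w + 4 / N\<^sup>2 * tot"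
    if "w \<in> {1..n}" "s \<in> {1..n}" for w s
    using complete_walk_state_2[OF that, of \<psi>] by (simp add: \<phi>_def N_def col_def row_def tot_def)
  \<comment> \<open>Since R maps the all-ones vector to its negative, the column sums of R\<psi>R
    are those of \<psi>R with the sign changed. The row sums behave symmetrically, and the total
    changes sign twice.\<close>
  have col': "(\<Sum>v=1..n. \<phi> (v, s)) = 2 / N * tot - col s" if "s \<in> {1..n}" for s
  proof -
    have "(\<Sum>v=1..n. \<phi> (v, s)) =
        (\<Sum>v=1..n. \<psi> (v, s) - 2 / N * col s - 2 / N * row v + 4 / N\<^sup>2 * tot)"
      using that by (intro sum.cong) (simp_all add: \<phi>)
    also have "\<dots> = col s - N * (2 / N * col s) - 2 / N * tot + N * (4 / N\<^sup>2 * tot)"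
      by (simp add: sum.distrib sum_subtractf col_def N_def flip: sum_distrib_left sum_divide_distrib row_tot)
    finally show ?thesis
      using \<open>N \<noteq> 0\<close> by (simp add: field_simps power2_eq_square)
  qed
  have row': "(\<Sum>v=1..n. \<phi> (w, v)) = 2 / N * tot - row w" if "w \<in> {1..n}" for w
  proof -
    have "(\<Sum>v=1..n. \<phi> (w, v)) =
        (\<Sum>v=1..n. \<psi> (w, v) - 2 / N * col v - 2 / N * row w + 4 / N\<^sup>2 * tot)"
      using that by (intro sum.cong) (simp_all add: \<phi>)
    also have "\<dots> = row w - 2 / N * tot - N * (2 / N * row w) + N * (4 / N\<^sup>2 * tot)"
      by (simp add: sum.distrib sum_subtractf row_def N_def tot_def
          flip: sum_distrib_left sum_divide_distrib)
    finally show ?thesis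
      using \<open>N \<noteq> 0\<close> by (simp add: field_simps power2_eq_square)
  qed
  have tot': "(\<Sum>u=1..n. \<Sum>v=1..n. \<phi> (v, u)) = tot"
  proof -
    have "(\<Sum>u=1..n. \<Sum>v=1..n. \<phi> (v, u)) = (\<Sum>u=1..n. 2 / N * tot - col u)"
      by (intro sum.cong refl col')
    also have "\<dots> = N * (2 / N * tot) - tot"
      by (simp add: sum_subtractf tot_def N_def)
    finally show ?thesis
      using \<open>N \<noteq> 0\<close> by simp
  qed
  have split: "?S \<psi> 4 = ?S \<phi> 2"
    using walk_state_add[of "complete_configs n" "complete_walk n" \<psi> 2 2] by (simp add: \<phi>_def)
  show "?S \<psi> 4 x = \<psi> x"
  proof (cases "x \<in> complete_configs n")
    \<comment> \<open>Outside the carrier \<open>apply_operator\<close> returns 0, so returning to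
      \<open>\<psi>\<close> relies on \<open>supp\<close>.\<close>
    case False
    then show ?thesis
      using supp by (simp add: numeral_eq_Suc apply_operator_def)
  next
    case True
    then obtain w s where x: "x = (w, s)" and ws: "w \<in> {1..n}" "s \<in> {1..n}"
      by (auto simp: complete_configs_def)
    have "?S \<phi> 2 (w, s) = \<phi> (w, s) - 2 / N * (2 / N * tot - col s) - 2 / N * (2 / N * tot - row w)
        + 4 / N\<^sup>2 * tot"
      using complete_walk_state_2[OF ws, of \<phi>] by (simp only: col'[OF ws(2)] row'[OF ws(1)] tot' N_def)
    \<comment> \<open>Expanding \<open>\<phi>\<close> cancels the row and column sums; the four
      multiples of \<open>tot\<close> have coefficients \<open>4 / N\<^sup>2\<close> with signs +,
      -, -, +.\<close>
    also have "\<dots> = \<psi> (w, s)"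
      using \<open>N \<noteq> 0\<close> by (simp add: \<phi>[OF ws] field_simps power2_eq_square)
    finally show ?thesis
      by (simp add: split x)
  qed
qed

lemma complete_walk_state_norm:
  assumes "n > 0" and "\<psi> \<in> unit_vectors (complete_configs n)"
  shows "(\<Sum>x\<in>complete_configs n.
    (cmod (walk_state (complete_configs n) (complete_walk n) \<psi> t x))\<^sup>2) = 1"
  using assms by (induction t) (simp_all add: unit_vectors_def L2_set_def complete_walk_norm)

section \<open>Bounds for the mixing distance and the mixing time\<close>

lemma mixing_distance_complete_le:
  assumes "n > 0" "T > 0" and \<psi>: "\<psi> \<in> unit_vectors (complete_configs n)"
  shows "mixing_distance (complete_configs n) (complete_walk n) T \<psi> \<le> 8 / real T"
proof -
  have "walk_state (complete_configs n) (complete_walk n) \<psi> 4 = \<psi>"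
    using \<psi> \<open>n > 0\<close> by (intro complete_walk_state_4) (auto simp: unit_vectors_def)
  then show ?thesis
    using mixing_distance_periodic_le[of 4 "complete_configs n" "complete_walk n" \<psi> T] assms
    by (simp add: complete_walk_state_norm)
qed

lemma complete_delta_unit_vector:
  assumes "n \<ge> 2"
  shows "(\<lambda>x. of_bool (x = (1, 2))) \<in> unit_vectors (complete_configs n)"
proof -
  have "(\<Sum>x\<in>complete_configs n. (cmod (of_bool (x = (1, 2))))\<^sup>2) =
      (\<Sum>x\<in>complete_configs n. if x = (1, 2) then 1 else 0)"
    by (intro sum.cong) auto
  also have "\<dots> = 1"
    using assms by (simp add: sum.delta complete_configs_def)
  finally show ?thesis
    using assms by (auto simp: unit_vectors_def L2_set_def complete_configs_def)
qed

lemma mixing_distance_complete_ge: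
  fixes \<psi> :: "nat \<times> nat \<Rightarrow> complex"
  assumes "n \<ge> 2" and "T mod 4 = 1"
  defines "\<psi> \<equiv> \<lambda>x. of_bool (x = (1, 2))"
  shows "mixing_distance (complete_configs n) (complete_walk n) T \<psi> \<ge> 1 / (4 * real T)"
proof -
  let ?X = "complete_configs n"
  define f where "f t x = (cmod (walk_state ?X (complete_walk n) \<psi> t x))\<^sup>2" for t x
  define p where "p = limit_distribution ?X (complete_walk n) \<psi>"
  have \<psi>: "\<psi> \<in> unit_vectors ?X"
    unfolding \<psi>_def using assms by (intro complete_delta_unit_vector)
  have finX: "finite ?X" and inX: "(1, 2) \<in> ?X"
    using assms by (auto simp: complete_configs_def)
  have norm: "(\<Sum>x\<in>?X. f t x) = 1" for t
    using complete_walk_state_norm[OF _ \<psi>] assms by (simp add: f_def)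
  have le1: "f t (1, 2) \<le> 1" for t
    using member_le_sum[of "(1, 2)" ?X "f t"] finX inX norm[of t] by (simp add: f_def)
  have period: "walk_state ?X (complete_walk n) \<psi> 4 = \<psi>"
    using \<psi> assms by (intro complete_walk_state_4) (auto simp: unit_vectors_def)
  have f0: "f 0 (1, 2) = 1"
    by (simp add: f_def \<psi>_def)
  \<comment> \<open>The new amplitude at \<open>(1, 2)\<close> involves only column 1 of
    \<open>\<psi>\<close>, and the single nonzero entry lies in column 2.\<close>
  have f1: "f 1 (1, 2) = 0"
    using assms by (simp add: f_def apply_complete_walk)
  have "p (1, 2) = (\<Sum>t<4. f t (1, 2)) / 4"
    using limit_distribution_periodic[OF _ period] by (simp add: p_def f_def)
  \<comment> \<open>The times 0 and 1 contribute 1 and 0, the times 2 and 3 at most 1 each.\<close>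
  also have "\<dots> \<le> 3 / 4"
    using le1[of 2] le1[of 3] f0 f1 by (simp add: numeral_eq_Suc)
  finally have "1 / 4 \<le> \<bar>f 0 (1, 2) - p (1, 2)\<bar>"
    using f0 by simp
  also have "\<dots> \<le> (\<Sum>x\<in>?X. \<bar>f 0 x - p x\<bar>)"
    using finX inX by (intro member_le_sum[where f = "\<lambda>x. \<bar>f 0 x - p x\<bar>"]) auto
  finally have "1 / 4 \<le> (\<Sum>x\<in>?X. \<bar>f 0 x - p x\<bar>)" .
  moreover have "T > 0"
    using assms by (intro gr0I) auto
  \<comment> \<open>As \<open>T mod 4 = 1\<close>, only the term of time 0 and one copy of the limit
    remain.\<close>
  then have "mixing_distance ?X (complete_walk n) T \<psi> = (\<Sum>x\<in>?X. \<bar>f 0 x - p x\<bar>) / real T"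
    using mixing_distance_periodic[OF _ period] assms by (simp add: f_def p_def)
  ultimately show ?thesis
    using \<open>T > 0\<close> by (simp add: field_simps)
qed

lemma complete_mixing_time_ge:
  assumes "n \<ge> 2" "\<epsilon> > 0"
  shows "ereal (1 / 16 / \<epsilon>) \<le> mixing_time (complete_configs n) (complete_walk n) \<epsilon>"
  unfolding mixing_time_def
\<comment> \<open>A single starting vector bounds the supremum from below. Bounding every admissible
  \<open>T\<close> by \<open>INF_greatest\<close> also covers an empty set, whose infimum is
  infinite.\<close>
proof (rule SUP_upper2[OF complete_delta_unit_vector[OF \<open>n \<ge> 2\<close>]], rule INF_greatest)
  fix T
  assume "T \<in> {T. T \<ge> 1 \<and> (\<forall>T'\<ge>T. mixing_distance (complete_configs n) (complete_walk n) T'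
    (\<lambda>x. of_bool (x = (1, 2))) \<le> \<epsilon>)}"
  then have T: "T \<ge> 1" and mixed: "\<And>T'. T' \<ge> T \<Longrightarrow>
      mixing_distance (complete_configs n) (complete_walk n) T' (\<lambda>x. of_bool (x = (1, 2))) \<le> \<epsilon>"
    by auto
  \<comment> \<open>The witness is the least number from \<open>T\<close> on that is congruent to 1
    modulo 4.\<close>
  obtain T' where T': "T \<le> T'" "T' \<le> T + 3" "T' mod 4 = 1"
  proof
    show "T \<le> 4 * ((T + 2) div 4) + 1" "4 * ((T + 2) div 4) + 1 \<le> T + 3"
      "(4 * ((T + 2) div 4) + 1) mod 4 = 1"
      by presburger+
  qed
  \<comment> \<open>From \<open>T \<ge> 1\<close> follows \<open>T' \<le> T + 3 \<le> 4 * T\<close>;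
    together with the factor 4 of the distance bound this gives the constant 16.\<close>
  have "1 / (4 * (4 * real T)) \<le> 1 / (4 * real T')"
    using T T' by (intro divide_left_mono mult_pos_pos) auto
  also have "\<dots> \<le> \<epsilon>"
    using mixing_distance_complete_ge[OF \<open>n \<ge> 2\<close> T'(3)] mixed[OF T'(1)] by linarith
  finally show "ereal (1 / 16 / \<epsilon>) \<le> ereal (real T)"
    using \<open>\<epsilon> > 0\<close> T by (simp add: field_simps)
qed

text \<open>Every time from \<open>8 / \<epsilon>\<close> on is good for all starting vectors at
  once. Rounding up costs at most 1, which is at most \<open>2 / \<epsilon>\<close> because
  \<open>\<epsilon> \<le> 2\<close>; hence the 10. Some upper limit on \<open>\<epsilon>\<close> is
  unavoidable, as admissible times are at least 1 while \<open>10 / \<epsilon>\<close> tends to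
  0.\<close>

lemma complete_mixing_time_le:
  assumes "n > 0" "\<epsilon> > 0" "\<epsilon> \<le> 2"
  shows "mixing_time (complete_configs n) (complete_walk n) \<epsilon> \<le> ereal (10 / \<epsilon>)"
  unfolding mixing_time_def
proof (rule SUP_least)
  fix \<psi>
  assume \<psi>: "\<psi> \<in> unit_vectors (complete_configs n)"
  define T where "T = nat \<lceil>8 / \<epsilon>\<rceil>"
  have T: "T \<ge> 1" "8 / \<epsilon> \<le> real T"
    using \<open>\<epsilon> > 0\<close> by (simp_all add: T_def Suc_le_eq real_nat_ceiling_ge)
  have "real T \<le> 8 / \<epsilon> + 1"
    using \<open>\<epsilon> > 0\<close> by (simp add: T_def)
  also have "\<dots> \<le> 10 / \<epsilon>"
    using assms by (simp add: field_simps)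
  finally have "ereal (real T) \<le> ereal (10 / \<epsilon>)" by simp
  moreover have "mixing_distance (complete_configs n) (complete_walk n) T' \<psi> \<le> \<epsilon>" if "T' \<ge> T" for T'
  proof -
    have "8 / \<epsilon> \<le> real T'" "T' > 0"
      using T that by auto
    then have "8 / real T' \<le> \<epsilon>"
      using \<open>\<epsilon> > 0\<close> by (simp add: field_simps)
    then show ?thesis
      using mixing_distance_complete_le[OF \<open>n > 0\<close> \<open>T' > 0\<close> \<psi>] by linarith
  qed
  ultimately show "(INF T\<in>{T. T \<ge> 1 \<and> (\<forall>T'\<ge>T.
      mixing_distance (complete_configs n) (complete_walk n) T' \<psi> \<le> \<epsilon>)}. ereal (real T)) \<le> ereal (10 / \<epsilon>)"
    using T by (intro INF_lower2[of T]) auto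
qed

theorem proposition2p3:
  shows "\<exists>c\<^sub>1 c\<^sub>2 :: real. c\<^sub>1 > 0 \<and> c\<^sub>2 > 0 \<and>
    (\<forall>n::nat. n \<ge> 2 \<longrightarrow> (\<forall>\<epsilon>::real. \<epsilon> > 0 \<longrightarrow>
      ereal (c\<^sub>1 / \<epsilon>) \<le> mixing_time (complete_configs n) (complete_walk n) \<epsilon> \<and>
      (\<epsilon> \<le> 2 \<longrightarrow> mixing_time (complete_configs n) (complete_walk n) \<epsilon> \<le> ereal (c\<^sub>2 / \<epsilon>))))"
proof (intro exI conjI allI impI)
  show "(1 / 16 :: real) > 0" "(10 :: real) > 0" by simp_all
qed (rule complete_mixing_time_ge complete_mixing_time_le; simp)+

end
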